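(* Let $\mathcal E$ be a real Hilbert space, $\psi\in\Gamma_0(\mathcal E)$, $E\subset\mathcal E$ a nonempty closed convex set, $\beta>0$, and $\Xi\in\Gamma_0(\mathcal E)$ a $\beta$-strongly convex function. Consider the Extended Level-Set method with pruning described in the context, and assume: (1) $\mathrm{dom}(\sigma_E)\cap\mathrm{dom}(\partial\Xi)\cap\mathrm{dom}(\psi)\neq\varnothing$; (2) for all $t\in\mathbb N$, $\partial\sigma_E(\mu^t)\ne\varnothing$, and there is a constant $C_{\mathrm{oracle}}$ such that $\|v^t\|\le C_{\mathrm{oracle}}$ for all $t\in\mathbb N$; (3) the set $E^{-1}$ is bounded and $\psi+\sigma_{E^{-1}}$ is coercive; (4) with $Q^{-1}=\{\mu\in\mathcal E:\psi(\mu)+\sigma_{E^{-1}}(\mu)\le\bar h^0\}$, we have $Q^{-1}\subset\mathrm{dom}(\Xi)$ and $\Xi$ is bounded over $Q^{-1}$; (5) for all $t\in\mathbb N$ there exists $w^{t+1}\in\partial\Xi(\mu^{t+1})$ such that $w^t-w^{t+1}\in N_{Q^t}(\mu^{t+1})$, and there is a constant $C_{\partial\Xi}>0$ such that $\|w^t\|\le C_{\partial\Xi}$ for all $t\in\mathbb N$; (6) there is a constant $C_\psi>0$ such that $|\psi(\mu^{t+1})-\psi(\mu^t)|\le C_\psi\|\mu^{t+1}-\mu^t\|$ for all $t\in\mathbb N$. Then the primal-dual gap $\Delta^t$ converges to $0$ with a speed of order $1/\sqrt t$, i.e. there exists $C>0$ such that $\Delta^t\le C/\sqrt t$ for all integers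 $t\ge1$.
   Context: Notation. $\Gamma_0(\mathcal E)$ is the set of proper convex lower semicontinuous functions $\mathcal E\to\mathbb R\cup\{+\infty\}$; $\mathrm{dom}(g)$ is the set where $g$ is finite; $\partial g$ is the convex subdifferential and $\mathrm{dom}(\partial g)=\{\partial g\neq\varnothing\}$; $\psi^*$ is the Legendre–Fenchel conjugate; $\sigma_S(\mu)=\sup_{x\in S}\langle\mu,x\rangle$; $\iota_S$ is $0$ on $S$ and $+\infty$ elsewhere; $N_S(\mu)$ is the normal cone of the convex set $S$ at $\mu$. $g$ is coercive if $g(x)\to+\infty$ as $\|x\|\to+\infty$. $\Xi$ is $\beta$-strongly convex if $\Xi-\frac\beta2\|\cdot\|^2$ is convex. For $\mu\in\mathcal E$, $\mu'\in\mathrm{dom}(\Xi)$, $w\in\mathcal E$, the Bregman distance is $B_\Xi(\mu,(\mu',w))=\Xi(\mu)-\Xi(\mu')-\langle\mu-\mu',w\rangle$ if $w\in\partial\Xi(\mu')$ and $+\infty$ otherwise. Extended Level-Set method with pruning for the problem $\min_{\mu\in\mathcal E}\psi(\mu)+\sigma_E(\mu)$. Input: $\mu^0\in\mathrm{dom}(\sigma_E)\cap\mathrm{dom}(\partial\Xi)\cap\mathrm{dom}(\psi)$, $w^0\in\partial\Xi(\mu^0)$, $E^{-1}\subset E$, $\lambda\in(0,1)$. Set $\bar h^{-1}=+\infty$ and $\bar\Delta=+\infty$. For $t=0,1,2,\dots$: 1. Choose $v^t\in\partial\sigma_E(\mu^t)$ and set $\tilde E^t=\overline{\mathrm{conv}}(E^{t-1}\cup\{v^t\})$.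 2. Set $\bar h^t=\min\{\bar h^{t-1},\psi(\mu^t)+\sigma_E(\mu^t)\}$, $\underline h^t=\inf_{\mu\in\mathcal E}\psi(\mu)+\sigma_{E^{t-1}\cup\{v^t\}}(\mu)$, $\Delta^t=\bar h^t-\underline h^t$, $\ell^t=\lambda\bar h^t+(1-\lambda)\underline h^t$, and take $\hat x^t$ a minimizer of $\psi^*+\iota_{-\tilde E^t}$ over $\mathcal E$. 3. Pruning: if $\Delta^t<(1-\lambda)\bar\Delta$, take any $E^t\subset\overline{\mathrm{conv}}(E^{t-1}\cup\{v^t\})$ such that $\{-\hat x^t\}\cup E^{-1}\subset\overline{\mathrm{conv}}(E^t)$, and set $\bar\Delta=\Delta^t$; otherwise set $E^t=E^{t-1}\cup\{v^t\}$. 4. Set $Q^t=\{\mu:\psi(\mu)+\sigma_{E^t}(\mu)\le\ell^t\}$. Let $\mu^{t+1}$ be the minimizer of $\mu\mapsto B_\Xi(\mu,(\mu^t,w^t))$ over $Q^t$, and take $w^{t+1}\in\partial\Xi(\mu^{t+1})$ with $w^t-w^{t+1}\in N_{Q^t}(\mu^{t+1})$. *)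

theory Defs
  imports "HOL-Analysis.Analysis"
begin

text \<open>
  Extended-valued functions are functions into \<^typ>\<open>ereal\<close>. There, infinity plus or minus
  anything is infinity, so the sums below are the usual ones of convex analysis for functions
  that do not take the value minus infinity.
\<close>

section \<open>Convex analysis\<close>

definition effective_domain :: "('a \<Rightarrow> ereal) \<Rightarrow> 'a set" where
  "effective_domain g = {x. \<bar>g x\<bar> \<noteq> \<infinity>}"

definition proper_fun :: "('a \<Rightarrow> ereal) \<Rightarrow> bool" where
  "proper_fun g \<longleftrightarrow> (\<forall>x. g x \<noteq> -\<infinity>) \<and> (\<exists>x. g x \<noteq> \<infinity>)"

definition convex_fun :: "('a::real_vector \<Rightarrow> ereal) \<Rightarrow> bool" where
  "convex_fun g \<longleftrightarrow> (\<forall>x y. \<forall>s\<in>{0<..<1::real}.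
     g ((1 - s) *\<^sub>R x + s *\<^sub>R y) \<le> ereal (1 - s) * g x + ereal s * g y)"

definition lower_semicontinuous :: "('a::topological_space \<Rightarrow> ereal) \<Rightarrow> bool" where
  "lower_semicontinuous g \<longleftrightarrow> (\<forall>x. g x \<le> Liminf (nhds x) g)"

definition Gamma0 :: "('a::real_normed_vector \<Rightarrow> ereal) set" where
  "Gamma0 = {g. proper_fun g \<and> convex_fun g \<and> lower_semicontinuous g}"

definition strongly_convex_fun :: "real \<Rightarrow> ('a::real_normed_vector \<Rightarrow> ereal) \<Rightarrow> bool" where
  "strongly_convex_fun \<beta> g \<longleftrightarrow> convex_fun (\<lambda>x. g x - ereal (\<beta> / 2 * (norm x)\<^sup>2))"

definition coercive :: "('a::real_normed_vector \<Rightarrow> ereal) \<Rightarrow> bool" where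
  "coercive g \<longleftrightarrow> (g \<longlongrightarrow> \<infinity>) at_infinity"

definition subdifferential :: "('a::real_inner \<Rightarrow> ereal) \<Rightarrow> 'a \<Rightarrow> 'a set" where
  "subdifferential g x = {w. \<forall>y. g x + ereal (w \<bullet> (y - x)) \<le> g y}"

definition subdifferential_domain :: "('a::real_inner \<Rightarrow> ereal) \<Rightarrow> 'a set" where
  "subdifferential_domain g = {x. subdifferential g x \<noteq> {}}"

definition fenchel_conjugate :: "('a::real_inner \<Rightarrow> ereal) \<Rightarrow> 'a \<Rightarrow> ereal" where
  "fenchel_conjugate g w = (SUP x. ereal (w \<bullet> x) - g x)"

definition support_function :: "'a::real_inner set \<Rightarrow> 'a \<Rightarrow> ereal" where
  "support_function S \<mu> = (SUP x\<in>S. ereal (\<mu> \<bullet> x))"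

definition convex_indicator :: "'a set \<Rightarrow> 'a \<Rightarrow> ereal" where
  "convex_indicator S x = (if x \<in> S then 0 else \<infinity>)"

definition normal_cone :: "'a::real_inner set \<Rightarrow> 'a \<Rightarrow> 'a set" where
  "normal_cone S \<mu> = (if \<mu> \<in> S then {w. \<forall>y\<in>S. w \<bullet> (y - \<mu>) \<le> 0} else {})"

definition bregman :: "('a::real_inner \<Rightarrow> ereal) \<Rightarrow> 'a \<Rightarrow> 'a \<times> 'a \<Rightarrow> ereal" where
  "bregman \<Xi> \<mu> = (\<lambda>(\<mu>', w). if w \<in> subdifferential \<Xi> \<mu>'
     then \<Xi> \<mu> - \<Xi> \<mu>' - ereal ((\<mu> - \<mu>') \<bullet> w) else \<infinity>)"


section \<open>The Extended Level-Set method with pruning\<close>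

text \<open>
  The sequence of bundles is shifted by one: \<^term>\<open>\<E> (t::nat)\<close> is $E^{t-1}$, the bundle available
  at the start of iteration \<^term>\<open>t::nat\<close>. In particular \<^term>\<open>\<E> (0::nat)\<close> is $E^{-1}$.
\<close>

primrec els_upper :: "('a::real_inner \<Rightarrow> ereal) \<Rightarrow> 'a set \<Rightarrow> (nat \<Rightarrow> 'a) \<Rightarrow> nat \<Rightarrow> ereal" where
  "els_upper \<psi> E \<mu> 0 = min \<infinity> (\<psi> (\<mu> 0) + support_function E (\<mu> 0))"
| "els_upper \<psi> E \<mu> (Suc t) =
     min (els_upper \<psi> E \<mu> t) (\<psi> (\<mu> (Suc t)) + support_function E (\<mu> (Suc t)))"

definition els_lower ::
  "('a::real_inner \<Rightarrow> ereal) \<Rightarrow> (nat \<Rightarrow> 'a set) \<Rightarrow> (nat \<Rightarrow> 'a) \<Rightarrow> nat \<Rightarrow> ereal" where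
  "els_lower \<psi> \<E> v t = (INF \<mu>. \<psi> \<mu> + support_function (\<E> t \<union> {v t}) \<mu>)"

definition els_gap ::
  "('a::real_inner \<Rightarrow> ereal) \<Rightarrow> 'a set \<Rightarrow> (nat \<Rightarrow> 'a set) \<Rightarrow> (nat \<Rightarrow> 'a) \<Rightarrow> (nat \<Rightarrow> 'a) \<Rightarrow> nat \<Rightarrow> ereal"
  where
  "els_gap \<psi> E \<E> \<mu> v t = els_upper \<psi> E \<mu> t - els_lower \<psi> \<E> v t"

definition els_level ::
  "('a::real_inner \<Rightarrow> ereal) \<Rightarrow> 'a set \<Rightarrow> real \<Rightarrow> (nat \<Rightarrow> 'a set) \<Rightarrow> (nat \<Rightarrow> 'a) \<Rightarrow> (nat \<Rightarrow> 'a)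
   \<Rightarrow> nat \<Rightarrow> ereal" where
  "els_level \<psi> E lam \<E> \<mu> v t =
     ereal lam * els_upper \<psi> E \<mu> t + ereal (1 - lam) * els_lower \<psi> \<E> v t"

text \<open>The value of the variable $\bar\Delta$ at the start of iteration \<^term>\<open>t::nat\<close>.\<close>

primrec els_ref_gap ::
  "('a::real_inner \<Rightarrow> ereal) \<Rightarrow> 'a set \<Rightarrow> real \<Rightarrow> (nat \<Rightarrow> 'a set) \<Rightarrow> (nat \<Rightarrow> 'a) \<Rightarrow> (nat \<Rightarrow> 'a)
   \<Rightarrow> nat \<Rightarrow> ereal" where
  "els_ref_gap \<psi> E lam \<E> \<mu> v 0 = \<infinity>"
| "els_ref_gap \<psi> E lam \<E> \<mu> v (Suc t) =
     (if els_gap \<psi> E \<E> \<mu> v t < ereal (1 - lam) * els_ref_gap \<psi> E lam \<E> \<mu> v t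
      then els_gap \<psi> E \<E> \<mu> v t else els_ref_gap \<psi> E lam \<E> \<mu> v t)"

definition els_Q ::
  "('a::real_inner \<Rightarrow> ereal) \<Rightarrow> 'a set \<Rightarrow> real \<Rightarrow> (nat \<Rightarrow> 'a set) \<Rightarrow> (nat \<Rightarrow> 'a) \<Rightarrow> (nat \<Rightarrow> 'a)
   \<Rightarrow> nat \<Rightarrow> 'a set" where
  "els_Q \<psi> E lam \<E> \<mu> v t =
     {x. \<psi> x + support_function (\<E> (Suc t)) x \<le> els_level \<psi> E lam \<E> \<mu> v t}"

text \<open>
  The sequences form a run of the method, for some admissible choice at every step that leaves
  one. The three conjuncts after the initialisation are the oracle and dual step, the bundle
  update, and the level-set projection.
\<close>

definition extended_level_set_run ::
  "('a::real_inner \<Rightarrow> ereal) \<Rightarrow> 'a set \<Rightarrow> ('a \<Rightarrow> ereal) \<Rightarrow> real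
   \<Rightarrow> (nat \<Rightarrow> 'a set) \<Rightarrow> (nat \<Rightarrow> 'a) \<Rightarrow> (nat \<Rightarrow> 'a) \<Rightarrow> (nat \<Rightarrow> 'a) \<Rightarrow> (nat \<Rightarrow> 'a) \<Rightarrow> bool" where
  "extended_level_set_run \<psi> E \<Xi> lam \<E> \<mu> w v xhat \<longleftrightarrow>
     \<mu> 0 \<in> effective_domain (support_function E) \<inter> subdifferential_domain \<Xi> \<inter> effective_domain \<psi> \<and>
     w 0 \<in> subdifferential \<Xi> (\<mu> 0) \<and> \<E> 0 \<subseteq> E \<and>
     (\<forall>t. v t \<in> subdifferential (support_function E) (\<mu> t) \<and>
        is_arg_min
          (\<lambda>x. fenchel_conjugate \<psi> x
             + convex_indicator (uminus ` closure (convex hull (\<E> t \<union> {v t}))) x)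
          (\<lambda>x. True) (xhat t)) \<and>
     (\<forall>t. if els_gap \<psi> E \<E> \<mu> v t < ereal (1 - lam) * els_ref_gap \<psi> E lam \<E> \<mu> v t
        then \<E> (Suc t) \<subseteq> closure (convex hull (\<E> t \<union> {v t})) \<and>
             {- xhat t} \<union> \<E> 0 \<subseteq> closure (convex hull (\<E> (Suc t)))
        else \<E> (Suc t) = \<E> t \<union> {v t}) \<and>
     (\<forall>t. is_arg_min (\<lambda>x. bregman \<Xi> x (\<mu> t, w t)) (\<lambda>x. x \<in> els_Q \<psi> E lam \<E> \<mu> v t) (\<mu> (Suc t)) \<and>
        w (Suc t) \<in> subdifferential \<Xi> (\<mu> (Suc t)) \<and>
        w t - w (Suc t) \<in> normal_cone (els_Q \<psi> E lam \<E> \<mu> v t) (\<mu> (Suc t)))"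

end

(*
The lower bounds increase: without pruning the model only grows, and after pruning the affine
minorant given by -xhat alone still attains the lower bound, by Fenchel duality. Hence the gap is
nonincreasing. In a group of iterations without pruning in which the gap shrinks by less than the
factor 1 - lam, all level sets share a point x. The Bregman distance to x decreases by at least
beta/2 times the squared step length, while each step is at least proportional to the gap, since
psi and the new cut are Lipschitz along the iterates. So a group ending with gap d has O(1/d^2)
iterations. The reference gaps at pruning decrease geometrically, so the total number of
iterations up to a gap d is dominated by a geometric series and is O(1/d^2) too.
*)

theory Submission
  imports Defs
begin

section \<open>Separation in Hilbert spaces\<close>

text \<open>A minimizing sequence for the norm is Cauchy by the parallelogram law, so completeness
  supplies the limit without any compactness. The inequality is the first-order condition at the
  minimizer.\<close>

lemma min_norm_point:
  fixes S :: "'a::{real_inner, complete_space} set"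
  assumes S: "S \<noteq> {}" "closed S" "convex S"
  obtains p where "p \<in> S" "\<And>y. y \<in> S \<Longrightarrow> p \<bullet> p \<le> p \<bullet> y"
proof -
  define m where "m = (INF x\<in>S. norm x ^ 2)"
  have bdd: "bdd_below ((\<lambda>x. norm x ^ 2) ` S)"
    by (rule bdd_belowI[of _ 0]) auto
  have m_le: "m \<le> norm x ^ 2" if "x \<in> S" for x
    unfolding m_def using bdd that by (rule cINF_lower)
  have "\<exists>x\<in>S. norm x ^ 2 < m + 1 / real (Suc n)" for n
    using cINF_less_iff[OF S(1) bdd, of "m + 1 / real (Suc n)"] by (simp add: m_def)
  then obtain f where f: "\<And>n. f n \<in> S" "\<And>n. norm (f n) ^ 2 < m + 1 / real (Suc n)"
    by metis
  \<comment> \<open>The midpoint of \<open>x\<close> and \<open>y\<close> lies in \<open>S\<close>,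
    so its squared norm is at least \<open>m\<close>; the rest is the parallelogram
    identity.\<close>
  have dist_le: "norm (x - y) ^ 2 \<le> 2 * (norm x ^ 2 - m) + 2 * (norm y ^ 2 - m)"
    if "x \<in> S" "y \<in> S" for x y
  proof -
    have "(1/2) *\<^sub>R x + (1/2) *\<^sub>R y \<in> S"
      using S(3) that by (rule convexD) auto
    from m_le[OF this] show ?thesis
      by (simp add: power2_norm_eq_inner inner_simps inner_commute)
  qed
  have "Cauchy f"
    unfolding Cauchy_def
  proof (intro allI impI)
    fix e :: real assume e: "e > 0"
    obtain N where N: "4 / real (Suc N) < e ^ 2"
    proof -
      obtain N where "inverse (real (Suc N)) < e ^ 2 / 4"
        using reals_Archimedean[of "e ^ 2 / 4"] e by auto
      then show ?thesis by (intro that[of N]) (simp add: field_simps)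
    qed
    have "dist (f i) (f j) < e" if "i \<ge> N" "j \<ge> N" for i j
    proof -
      have le: "1 / real (Suc i) \<le> 1 / real (Suc N)" "1 / real (Suc j) \<le> 1 / real (Suc N)"
        using that by (auto intro!: divide_left_mono)
      have "norm (f i - f j) ^ 2 < 4 / real (Suc N)"
        using dist_le[OF f(1)[of i] f(1)[of j]] f(2)[of i] f(2)[of j] le by argo
      then have "norm (f i - f j) ^ 2 < e ^ 2" using N by simp
      then show ?thesis
        using e by (simp add: dist_norm power_less_imp_less_base)
    qed
    then show "\<exists>M. \<forall>i\<ge>M. \<forall>j\<ge>M. dist (f i) (f j) < e" by blast
  qed
  then obtain p where p: "f \<longlonglongrightarrow> p"
    using Cauchy_convergent convergent_def by blast
  have pS: "p \<in> S"
    using S(2) f(1) p closed_sequentially by blast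
  have "(\<lambda>n. m + 1 / real (Suc n)) \<longlonglongrightarrow> m + 0"
    by (intro tendsto_intros LIMSEQ_Suc[OF lim_1_over_n])
  then have "norm p ^ 2 \<le> m"
    using LIMSEQ_le[OF tendsto_power[OF tendsto_norm[OF p], of 2]] f(2) by (force intro: less_imp_le)
  have "p \<bullet> p \<le> p \<bullet> y" if y: "y \<in> S" for y
  proof (rule ccontr)
    define d where "d = y - p"
    assume "\<not> p \<bullet> p \<le> p \<bullet> y"
    then have neg: "p \<bullet> d < 0" by (simp add: d_def inner_simps)
    then have dpos: "d \<bullet> d > 0" by auto
    \<comment> \<open>The uncapped value minimizes the quadratic norm of \<open>p\<close> plus s
      times \<open>d\<close>; the cap at 1 keeps the point on the segment from \<open>p\<close> to
      \<open>y\<close>.\<close>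
    define s where "s = min 1 (- (p \<bullet> d) / (d \<bullet> d))"
    have s: "0 < s" "s \<le> 1" "s * (d \<bullet> d) \<le> - (p \<bullet> d)"
      using neg dpos by (auto simp: s_def min_def field_simps)
    have "(1 - s) *\<^sub>R p + s *\<^sub>R y \<in> S"
      using S(3) pS y s by (intro convexD) auto
    then have "p + s *\<^sub>R d \<in> S"
      by (simp add: d_def algebra_simps)
    from m_le[OF this] have "p \<bullet> p \<le> (p + s *\<^sub>R d) \<bullet> (p + s *\<^sub>R d)"
      using \<open>norm p ^ 2 \<le> m\<close> by (simp add: power2_norm_eq_inner)
    then have "0 \<le> s * (2 * (p \<bullet> d) + s * (d \<bullet> d))"
      by (simp add: inner_simps inner_commute algebra_simps)
    then have "0 \<le> 2 * (p \<bullet> d) + s * (d \<bullet> d)"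
      using s(1) by (simp add: zero_le_mult_iff)
    then show False using s neg by linarith
  qed
  with pS show ?thesis by (rule that)
qed

text \<open>After translating \<open>z\<close> to the origin, the point \<open>p\<close> of least
  norm serves as the normal, with margin \<open>p \<bullet> p\<close>.\<close>

lemma separating_hyperplane_point:
  fixes S :: "'a::{real_inner, complete_space} set"
  assumes S: "closed S" "convex S" and z: "z \<notin> S"
  obtains a c where "a \<bullet> z < c" "\<And>y. y \<in> S \<Longrightarrow> c \<le> a \<bullet> y"
proof (cases "S = {}")
  case True
  then show ?thesis using that[of 0 1] by simp
next
  case False
  define T where "T = (\<lambda>x. x - z) ` S"
  have T: "T \<noteq> {}" "closed T" "convex T"
    using False closed_translation_subtract[OF S(1), of z] S(2)
    by (auto simp: T_def convex_translation_subtract_eq)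
  obtain p where p: "p \<in> T" "\<And>y. y \<in> T \<Longrightarrow> p \<bullet> p \<le> p \<bullet> y"
    using min_norm_point[OF T] by blast
  obtain q where "q \<in> S" "p = q - z" using p(1) unfolding T_def by blast
  then have "p \<noteq> 0" using z by auto
  then have pp: "0 < p \<bullet> p" by simp
  show ?thesis
  proof (rule that)
    show "p \<bullet> z < p \<bullet> z + p \<bullet> p" using pp by simp
    fix y assume "y \<in> S"
    then have "p \<bullet> p \<le> p \<bullet> (y - z)" by (intro p(2)) (simp add: T_def)
    then show "p \<bullet> z + p \<bullet> p \<le> p \<bullet> y" by (simp add: inner_simps)
  qed
qed

section \<open>Support functions\<close>

lemma support_function_ge: "x \<in> S \<Longrightarrow> ereal (\<mu> \<bullet> x) \<le> support_function S \<mu>"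
  unfolding support_function_def by (rule SUP_upper)

lemma support_function_mono: "S \<subseteq> T \<Longrightarrow> support_function S \<mu> \<le> support_function T \<mu>"
  unfolding support_function_def by (rule SUP_subset_mono) auto

lemma support_function_Un:
  "support_function (S \<union> T) \<mu> = max (support_function S \<mu>) (support_function T \<mu>)"
  unfolding support_function_def sup_max[symmetric] by (rule SUP_union)

lemma support_function_singleton: "support_function {x} \<mu> = ereal (\<mu> \<bullet> x)"
  by (simp add: support_function_def)

lemma support_function_not_minf: "S \<noteq> {} \<Longrightarrow> support_function S \<mu> \<noteq> -\<infinity>"
  using support_function_ge[of _ S \<mu>] by fastforce

text \<open>A closed halfspace containing \<open>S\<close> is closed and convex, hence contains the
  closed hull. Pruning constrains bundles only through closed hulls, and this makes such constraints
  usable.\<close>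

lemma support_function_closure_hull:
  "support_function (closure (convex hull S)) \<mu> = support_function S \<mu>"
proof (rule antisym)
  have "ereal (\<mu> \<bullet> x) \<le> support_function S \<mu>" if x: "x \<in> closure (convex hull S)" for x
  proof (cases "support_function S \<mu>")
    case (real c)
    have "closure (convex hull S) \<subseteq> {x. \<mu> \<bullet> x \<le> c}"
      using support_function_ge[of _ S \<mu>] real
      by (intro closure_minimal hull_minimal convex_halfspace_le closed_halfspace_le) auto
    then show ?thesis using x real by auto
  next
    case MInf
    then have "S = {}" using support_function_not_minf by blast
    then show ?thesis using x by simp
  qed simp
  then show "support_function (closure (convex hull S)) \<mu> \<le> support_function S \<mu>"
    unfolding support_function_def[of "closure _"] by (rule SUP_least)
  show "support_function S \<mu> \<le> support_function (closure (convex hull S)) \<mu>"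
    by (rule support_function_mono) (meson closure_subset hull_subset order_trans)
qed

lemma support_function_subset_hull:
  "S \<subseteq> closure (convex hull T) \<Longrightarrow> support_function S \<mu> \<le> support_function T \<mu>"
  using support_function_mono[of S "closure (convex hull T)" \<mu>]
  by (simp add: support_function_closure_hull)

text \<open>The offset \<open>c\<close> is negligible against large \<open>s\<close>. This is how
  separating inequalities are read off along a ray.\<close>

lemma le_if_scaled_le:
  fixes a b c :: real
  assumes "\<And>s. s > 0 \<Longrightarrow> c + s * a \<le> s * b"
  shows "a \<le> b"
proof (rule ccontr)
  assume "\<not> a \<le> b"
  then have pos: "a - b > 0" by simp
  define s where "s = (\<bar>c\<bar> + 1) / (a - b)"
  have "s > 0" using pos by (simp add: s_def)
  moreover have "s * (a - b) = \<bar>c\<bar> + 1"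
    using pos by (simp add: s_def)
  ultimately show False using assms[of s] by (simp add: right_diff_distrib)
qed

text \<open>Testing the subgradient inequality at \<open>s *\<^sub>R y\<close> for large \<open>s\<close> replaces the
  separation argument that would give \<open>v \<in> S\<close>; that membership is never needed.\<close>

lemma support_function_subgradient:
  assumes v: "v \<in> subdifferential (support_function S) \<mu>" and S: "S \<noteq> {}"
  shows "ereal (y \<bullet> v) \<le> support_function S y"
    and "support_function S \<mu> = ereal (\<mu> \<bullet> v)"
proof -
  have sub: "support_function S \<mu> + ereal (v \<bullet> (y - \<mu>)) \<le> support_function S y" for y
    using v by (simp add: subdifferential_def)
  have zero: "support_function S 0 = 0"
    using S by (simp add: support_function_def zero_ereal_def)
  \<comment> \<open>The subgradient inequality at 0, where the support function vanishes, shows that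
    its value at \<open>\<mu>\<close> is finite.\<close>
  have le: "support_function S \<mu> \<le> ereal (\<mu> \<bullet> v)"
    using sub[of 0] zero by (cases "support_function S \<mu>") (auto simp: inner_commute)
  then obtain c where c: "support_function S \<mu> = ereal c"
    using support_function_not_minf[OF S, of \<mu>] by (cases "support_function S \<mu>") auto
  have ge: "ereal (y \<bullet> v) \<le> support_function S y" for y
  proof (cases "support_function S y")
    case (real r)
    have "(c - v \<bullet> \<mu>) + s * (v \<bullet> y) \<le> s * r" if s: "s > 0" for s
    proof -
      have "support_function S (s *\<^sub>R y) \<le> ereal (s * r)"
        unfolding support_function_def
      proof (rule SUP_least)
        fix x assume "x \<in> S"
        then have "y \<bullet> x \<le> r" using support_function_ge[of x S y] real by simp
        then show "ereal (s *\<^sub>R y \<bullet> x) \<le> ereal (s * r)" using s by simp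
      qed
      with sub[of "s *\<^sub>R y"] have "ereal c + ereal (v \<bullet> (s *\<^sub>R y - \<mu>)) \<le> ereal (s * r)"
        unfolding c by (rule order_trans)
      then show ?thesis by (simp add: inner_simps)
    qed
    then have "v \<bullet> y \<le> r" by (rule le_if_scaled_le)
    then show ?thesis using real by (simp add: inner_commute)
  qed (use support_function_not_minf[OF S, of y] in auto)
  show "ereal (y \<bullet> v) \<le> support_function S y" by (rule ge)
  show "support_function S \<mu> = ereal (\<mu> \<bullet> v)" using le ge[of \<mu>] by (rule antisym)
qed

section \<open>Fenchel duality for bounded support functions\<close>

lemma convex_epigraph:
  assumes "convex_fun g"
  shows "convex {a. g (fst a) \<le> ereal (snd a)}"
  unfolding convex_alt
proof (intro ballI allI impI)
  fix a b and s :: real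
  assume a: "a \<in> {a. g (fst a) \<le> ereal (snd a)}" and b: "b \<in> {a. g (fst a) \<le> ereal (snd a)}"
    and s: "0 \<le> s \<and> s \<le> 1"
  \<comment> \<open>\<open>convex_fun\<close> speaks of weights strictly between 0 and 1 only, so
    the endpoints are split off.\<close>
  show "(1 - s) *\<^sub>R a + s *\<^sub>R b \<in> {a. g (fst a) \<le> ereal (snd a)}"
  proof (cases "s = 0 \<or> s = 1")
    case True
    then show ?thesis using a b by auto
  next
    case False
    then have s': "s \<in> {0<..<1}" using s by auto
    have "g ((1 - s) *\<^sub>R fst a + s *\<^sub>R fst b) \<le> ereal (1 - s) * g (fst a) + ereal s * g (fst b)"
      using assms s' unfolding convex_fun_def by blast
    also have "\<dots> \<le> ereal (1 - s) * ereal (snd a) + ereal s * ereal (snd b)"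
      using a b s' by (intro add_mono ereal_mult_left_mono) auto
    finally show ?thesis by simp
  qed
qed

text \<open>Strictly separate \<open>(0, h - \<epsilon>)\<close> from the Minkowski sum of the epigraphs of \<open>g\<close> and of the
  reflected support function. The latter is Lipschitz because \<open>S\<close> is bounded, which keeps the
  closure of the sum away from the point. Allowing the loss \<open>\<epsilon>\<close> avoids Hahn--Banach and weak
  compactness: projection onto closed convex sets suffices.\<close>

lemma fenchel_duality_approx:
  fixes g :: "'a::{real_inner, complete_space} \<Rightarrow> ereal"
  assumes g: "convex_fun g" "proper_fun g"
    and S: "bounded S" "S \<noteq> {}"
    and h: "\<And>x. ereal h \<le> g x + support_function S x"
    and eps: "\<epsilon> > 0"
  obtains p where "p \<in> closure (convex hull S)" "\<And>x. ereal (h - \<epsilon>) \<le> g x + ereal (p \<bullet> x)"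
proof -
  obtain R where R: "\<And>z. z \<in> S \<Longrightarrow> norm z \<le> R" "R > 0"
    using S(1) by (meson bounded_pos)
  define A where "A = {a. g (fst a) \<le> ereal (snd a)}"
  \<comment> \<open>The epigraph of the reflected support function: \<open>(d, u)\<close> belongs to
    it iff \<open>u\<close> dominates the support function at \<open>- d\<close>.\<close>
  define B where "B = {b :: 'a \<times> real. \<forall>z\<in>S. 0 \<le> fst b \<bullet> z + snd b}"
  define K where "K = (\<Union>a\<in>A. \<Union>b\<in>B. {a + b})"
  have "convex A" unfolding A_def using g(1) by (rule convex_epigraph)
  moreover have "convex B"
  proof -
    have "B = (\<Inter>z\<in>S. {b. (z, 1) \<bullet> b \<ge> 0})"
      by (auto simp: B_def inner_prod_def inner_commute)
    then show ?thesis by (simp add: convex_INT convex_halfspace_ge)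
  qed
  ultimately have cK: "convex K" unfolding K_def by (rule convex_sums)
  \<comment> \<open>Moving from \<open>- fst b\<close> to \<open>fst a\<close> changes the support
    function by at most \<open>R\<close> times the norm of \<open>fst k\<close>. The resulting bound
    is a closed condition, so it survives on \<open>closure K\<close>.\<close>
  have K_far: "h \<le> snd k + R * norm (fst k)" if k: "k \<in> K" for k
  proof -
    obtain a b where ab: "a \<in> A" "b \<in> B" "k = a + b" using k by (auto simp: K_def)
    have "support_function S (fst a) \<le> ereal (snd b + R * norm (fst k))"
      unfolding support_function_def
    proof (rule SUP_least)
      fix z assume z: "z \<in> S"
      have "fst a \<bullet> z = fst k \<bullet> z - fst b \<bullet> z" using ab(3) by (simp add: inner_simps)
      also have "\<dots> \<le> norm (fst k) * norm z + snd b"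
        using ab(2) z norm_cauchy_schwarz[of "fst k" z] by (force simp: B_def)
      also have "\<dots> \<le> snd b + R * norm (fst k)"
        using mult_left_mono[OF R(1)[OF z], of "norm (fst k)"] by (simp add: mult.commute)
      finally show "ereal (fst a \<bullet> z) \<le> ereal (snd b + R * norm (fst k))" by simp
    qed
    moreover have "g (fst a) \<le> ereal (snd a)" using ab(1) by (simp add: A_def)
    ultimately have "ereal h \<le> ereal (snd a) + ereal (snd b + R * norm (fst k))"
      using h[of "fst a"] by (meson add_mono order_trans)
    then show ?thesis using ab(3) by simp
  qed
  have "closure K \<subseteq> {k. h \<le> snd k + R * norm (fst k)}"
    using K_far by (intro closure_minimal closed_Collect_le continuous_intros) auto
  then have "(0, h - \<epsilon>) \<notin> closure K" using eps by auto
  then obtain aq c where "aq \<bullet> (0, h - \<epsilon>) < c" "\<And>k. k \<in> closure K \<Longrightarrow> c \<le> aq \<bullet> k"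
    using separating_hyperplane_point[OF closed_closure convex_closure[OF cK]] by metis
  then have aq: "aq \<bullet> (0, h - \<epsilon>) < aq \<bullet> k" if "k \<in> closure K" for k
    using that by (meson less_le_trans)
  obtain a q where aq_eq: "aq = (a, q)" by (cases aq)
  have sep: "q * (h - \<epsilon>) < a \<bullet> (x + d) + q * (s + u)"
    if "g x \<le> ereal s" "\<And>z. z \<in> S \<Longrightarrow> 0 \<le> d \<bullet> z + u" for x d s u
  proof -
    have "(x, s) \<in> A" "(d, u) \<in> B" using that by (auto simp: A_def B_def)
    then have "(x, s) + (d, u) \<in> K" unfolding K_def by blast
    then have "(x, s) + (d, u) \<in> closure K" using closure_subset by blast
    from aq[OF this] show ?thesis by (simp add: aq_eq)
  qed
  obtain x0 s0 where x0: "g x0 = ereal s0"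
    using g(2) unfolding proper_fun_def by (metis ereal_cases)
  \<comment> \<open>With this height \<open>(- x0, u0)\<close> lies in \<open>B\<close>, so
    \<open>K\<close> contains the vertical ray over 0 from \<open>s0 + u0\<close> upwards;
    \<open>line\<close> tests it to exclude a nonpositive \<open>q\<close>.\<close>
  define u0 where "u0 = R * norm x0"
  have u0: "0 \<le> (- x0) \<bullet> z + u0" if "z \<in> S" for z
  proof -
    have "x0 \<bullet> z \<le> norm x0 * norm z" by (rule norm_cauchy_schwarz)
    also have "\<dots> \<le> u0"
      unfolding u0_def using mult_left_mono[OF R(1)[OF that], of "norm x0"] by (simp add: mult.commute)
    finally show ?thesis by simp
  qed
  have line: "0 < q * (c + (s0 + u0 - (h - \<epsilon>)))" if "c \<ge> 0" for c
    using sep[of x0 "s0 + c" "- x0" u0] u0 x0 that by (simp add: algebra_simps)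
  have "0 < q"
  proof (rule ccontr)
    assume "\<not> 0 < q"
    then have "q * (\<bar>s0 + u0 - (h - \<epsilon>)\<bar> + (s0 + u0 - (h - \<epsilon>))) \<le> 0"
      by (intro mult_nonpos_nonneg) auto
    with line[of "\<bar>s0 + u0 - (h - \<epsilon>)\<bar>"] show False by simp
  qed
  define p where "p = (1 / q) *\<^sub>R a"
  have sep': "h - \<epsilon> \<le> p \<bullet> (x + d) + (s + u)"
    if "g x \<le> ereal s" "\<And>z. z \<in> S \<Longrightarrow> 0 \<le> d \<bullet> z + u" for x d s u
    using sep[OF that] \<open>0 < q\<close> by (simp add: p_def field_simps)
  have "p \<in> closure (convex hull S)"
  proof (rule ccontr)
    assume "p \<notin> closure (convex hull S)"
    then obtain b c where b: "b \<bullet> p < c" "\<And>y. y \<in> closure (convex hull S) \<Longrightarrow> c \<le> b \<bullet> y"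
      using separating_hyperplane_point[OF closed_closure convex_closure[OF convex_convex_hull]]
      by metis
    have bS: "c \<le> b \<bullet> z" if "z \<in> S" for z
      using b(2)[of z] that closure_subset hull_subset[of S convex] by blast
    \<comment> \<open>Since \<open>c\<close> is a lower bound of \<open>b\<close> on
      \<open>S\<close>, every positive multiple of \<open>(b, - c)\<close> lies in \<open>B\<close>.
      Long multiples force \<open>c \<le> b \<bullet> p\<close>.\<close>
    have "(h - \<epsilon> - p \<bullet> x0 - s0) + t * c \<le> t * (b \<bullet> p)" if "t > 0" for t
      using sep'[of x0 s0 "t *\<^sub>R b" "- (t * c)"] x0 bS that
      by (simp add: inner_simps inner_commute)
    then have "c \<le> b \<bullet> p" by (rule le_if_scaled_le)
    then show False using b(1) by simp
  qed
  moreover have "ereal (h - \<epsilon>) \<le> g x + ereal (p \<bullet> x)" for x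
  proof (cases "g x")
    case (real s)
    then show ?thesis using sep'[of x s 0 0] by simp
  qed (use g(2) in \<open>auto simp: proper_fun_def\<close>)
  ultimately show ?thesis by (rule that)
qed

section \<open>Strong convexity\<close>

text \<open>At a point of the segment, strong convexity bounds \<open>g\<close> above and the
  subgradient bounds it below. Dividing by \<open>s\<close> leaves the quadratic term with factor
  \<open>1 - s\<close>, and \<open>s\<close> tends to 0.\<close>

lemma strongly_convex_subgradient:
  assumes sc: "strongly_convex_fun \<beta> g" and w: "w \<in> subdifferential g x"
    and gx: "g x = ereal a" and gy: "g y = ereal b"
  shows "a + w \<bullet> (y - x) + \<beta> / 2 * (norm (y - x))\<^sup>2 \<le> b"
proof -
  define d where "d = y - x"
  define c where "c = \<beta> / 2"
  define k where "k = c * (d \<bullet> d)"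
  have y: "y = x + d" by (simp add: d_def)
  have le: "a + w \<bullet> d + (1 - s) * k \<le> b" if s: "s \<in> {0<..<1}" for s
  proof -
    let ?z = "(1 - s) *\<^sub>R x + s *\<^sub>R y"
    have z: "?z = x + s *\<^sub>R d" by (simp add: y algebra_simps)
    have "g ?z - ereal (c * (norm ?z)\<^sup>2)
        \<le> ereal (1 - s) * (g x - ereal (c * (norm x)\<^sup>2))
          + ereal s * (g y - ereal (c * (norm y)\<^sup>2))"
      using sc s unfolding strongly_convex_fun_def convex_fun_def c_def by blast
    then have up: "g ?z \<le> ereal ((1 - s) * (a - c * (norm x)\<^sup>2)
        + s * (b - c * (norm y)\<^sup>2) + c * (norm ?z)\<^sup>2)"
      unfolding gx gy by (cases "g ?z") (auto simp: algebra_simps)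
    have low: "ereal (a + w \<bullet> (?z - x)) \<le> g ?z"
      using w gx unfolding subdifferential_def by (metis (mono_tags, lifting) mem_Collect_eq plus_ereal.simps(1))
    have "a + w \<bullet> (?z - x) \<le> (1 - s) * (a - c * (norm x)\<^sup>2)
        + s * (b - c * (norm y)\<^sup>2) + c * (norm ?z)\<^sup>2"
      using order_trans[OF low up] by simp
    then have "s * (a + w \<bullet> d + (1 - s) * k) \<le> s * b"
      unfolding z y power2_norm_eq_inner k_def
      by (simp add: inner_add_left inner_add_right inner_commute algebra_simps)
    then show ?thesis using s by simp
  qed
  have "a + w \<bullet> d + k \<le> b"
  proof (rule ccontr)
    assume "\<not> a + w \<bullet> d + k \<le> b"
    then have e: "0 < a + w \<bullet> d + k - b" (is "0 < ?e") by simp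
    \<comment> \<open>Small enough that the missing part \<open>s * k\<close> is at most half of the
      assumed violation.\<close>
    define s where "s = min (1/2) (?e / (2 * (\<bar>k\<bar> + 1)))"
    have s: "s \<in> {0<..<1}" using e by (auto simp: s_def)
    have "s * k \<le> s * (\<bar>k\<bar> + 1)" using s by (intro mult_left_mono) auto
    also have "\<dots> \<le> ?e / (2 * (\<bar>k\<bar> + 1)) * (\<bar>k\<bar> + 1)"
      by (intro mult_right_mono) (auto simp: s_def)
    also have "\<dots> = ?e / 2" by (simp add: field_simps)
    finally show False using le[OF s] e by (simp add: algebra_simps)
  qed
  then show ?thesis by (simp add: k_def c_def d_def power2_norm_eq_inner)
qed

section \<open>Counting iterations\<close>

text \<open>The predicate \<open>P\<close> marks the pruning iterations. A stretch between two of them is cut at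
  the first index where \<open>D\<close> reaches its final value: the hypothesis on groups needs the
  strict inequality \<open>D e > q * D s\<close>, while absence of pruning only gives the weak one.\<close>

lemma gap_square_bound:
  fixes D :: "nat \<Rightarrow> real"
  assumes q: "0 < q" "q < 1" and D0: "\<And>t. 0 \<le> D t" and dec: "\<And>s t. s \<le> t \<Longrightarrow> D t \<le> D s"
    and P0: "P 0"
    and P_iff: "\<And>p t. p \<le> t \<Longrightarrow> P p \<Longrightarrow> \<forall>j\<in>{p<..t}. \<not> P j \<Longrightarrow> P (Suc t) \<longleftrightarrow> D (Suc t) < q * D p"
    and group: "\<And>s e. s \<le> e \<Longrightarrow> \<forall>j\<in>{s<..e}. \<not> P j \<Longrightarrow> q * D s < D e
      \<Longrightarrow> real (e - s) * (D e)\<^sup>2 \<le> C"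
    and C: "0 \<le> C"
  shows "\<exists>K. \<forall>t. real t * (D t)\<^sup>2 \<le> K"
proof -
  \<comment> \<open>A stretch splits into at most two groups, costing \<open>C\<close> each, and one
    step between them, costing at most the initial squared gap.\<close>
  define C2 where "C2 = 2 * C + (D 0)\<^sup>2"
  have sq: "(D t)\<^sup>2 \<le> (D s)\<^sup>2" if "s \<le> t" for s t
    using dec[OF that] D0[of t] by (rule power_mono)
  have last: "\<exists>p\<le>t. P p \<and> (\<forall>j\<in>{p<..t}. \<not> P j)" for t
  proof (induction t)
    case 0
    then show ?case using P0 by auto
  next
    case (Suc t)
    show ?case
    proof (cases "P (Suc t)")
      case False
      from Suc obtain p where "p \<le> t" "P p" "\<forall>j\<in>{p<..t}. \<not> P j" by blast
      with False show ?thesis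
        by (intro exI[of _ p]) (auto simp: le_Suc_eq)
    qed (auto intro: exI[of _ "Suc t"])
  qed
  have stretch: "real (t - p) * (D t)\<^sup>2 \<le> C2"
    if p: "p \<le> t" "P p" "\<forall>j\<in>{p<..t}. \<not> P j" for p t
  proof (cases "q * D p < D t")
    case True
    from group[OF p(1,3) True] C show ?thesis
      unfolding C2_def by (smt (verit) zero_le_power2)
  next
    case False
    have weak: "q * D p \<le> D t"
    proof (cases "t = p")
      case True
      then show ?thesis using q D0[of p] by (simp add: mult_left_le_one_le)
    next
      case False
      then obtain t' where t': "t = Suc t'" "p \<le> t'" using p(1) by (cases t) auto
      have "\<not> P t" using p False by auto
      then show ?thesis using P_iff[of p t'] p t' by auto
    qed
    then have eq: "D t = q * D p" using False by simp
    show ?thesis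
    proof (cases "D t = 0")
      case True
      then show ?thesis using C by (simp add: C2_def)
    next
      case nz: False
      then have pos: "0 < D t" using D0[of t] by simp
      \<comment> \<open>The drop to the final value happens between \<open>m - 1\<close> and
        \<open>m\<close>. From \<open>p\<close> to \<open>m - 1\<close> the gap stays strictly above
        \<open>q * D p\<close>, and from \<open>m\<close> to \<open>t\<close> it is constant and
        positive, so both pieces are groups.\<close>
      define m where "m = (LEAST m. D m = D t)"
      have m: "D m = D t" "m \<le> t" "\<And>j. j < m \<Longrightarrow> D j \<noteq> D t"
        unfolding m_def by (auto intro: LeastI Least_le dest: not_less_Least)
      have "D p \<noteq> D t" using eq pos q by (metis mult_cancel_right1 less_irrefl)
      then have "p < m" using m(1,2) dec p(1) by (metis linorder_not_less dec order_antisym)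
      have g1: "real (t - m) * (D t)\<^sup>2 \<le> C"
        using \<open>p < m\<close> p m q pos by (intro group) auto
      have "D t < D (m - 1)"
        using m(3)[of "m - 1"] dec[of "m - 1" m] m(1) \<open>p < m\<close> by force
      then have "real (m - 1 - p) * (D (m - 1))\<^sup>2 \<le> C"
        using \<open>p < m\<close> p m eq by (intro group) auto
      moreover have "(D t)\<^sup>2 \<le> (D (m - 1))\<^sup>2" using m(2) by (intro sq) simp
      ultimately have g2: "real (m - 1 - p) * (D t)\<^sup>2 \<le> C"
        by (meson mult_left_mono of_nat_0_le_iff order_trans)
      have "real (t - p) = real (t - m) + 1 + real (m - 1 - p)"
        using \<open>p < m\<close> m(2) by (simp add: of_nat_diff)
      then have "real (t - p) * (D t)\<^sup>2
          = real (t - m) * (D t)\<^sup>2 + (D t)\<^sup>2 + real (m - 1 - p) * (D t)\<^sup>2"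
        by (simp add: algebra_simps)
      then show ?thesis
        unfolding C2_def using g1 g2 sq[of 0 t] by simp
    qed
  qed
  have q2: "q\<^sup>2 < 1" using q by (simp add: power_less_one_iff)
  \<comment> \<open>The fixed point of the recursion from one pruning to the next: the earlier
    iterations contribute with factor \<open>q\<^sup>2\<close>, the stretch with \<open>C2\<close>,
    and the pruning step with the initial squared gap.\<close>
  define K where "K = (C2 + (D 0)\<^sup>2) / (1 - q\<^sup>2)"
  have K: "q\<^sup>2 * K + C2 + (D 0)\<^sup>2 = K"
    using q2 unfolding K_def by (simp add: field_simps)
  have K0: "0 \<le> K" unfolding K_def C2_def using q2 C by simp
  have pruned: "real t * (D t)\<^sup>2 \<le> K" if "P t" for t
    using that
  proof (induction t rule: less_induct)
    case (less t)
    show ?case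
    proof (cases t)
      case 0
      then show ?thesis using K0 by simp
    next
      case (Suc t')
      obtain p where p: "p \<le> t'" "P p" "\<forall>j\<in>{p<..t'}. \<not> P j" using last by blast
      have "D t < q * D p" using P_iff[OF p] less.prems Suc by simp
      then have "(D t)\<^sup>2 \<le> (q * D p)\<^sup>2" using D0[of t] by (intro power_mono) auto
      then have "real p * (D t)\<^sup>2 \<le> real p * (q\<^sup>2 * (D p)\<^sup>2)"
        by (intro mult_left_mono) (auto simp: power_mult_distrib)
      also have "\<dots> = q\<^sup>2 * (real p * (D p)\<^sup>2)" by simp
      also have "\<dots> \<le> q\<^sup>2 * K" using less.IH[of p] p Suc by (intro mult_left_mono) auto
      finally have a: "real p * (D t)\<^sup>2 \<le> q\<^sup>2 * K" .
      have "real (t' - p) * (D t)\<^sup>2 \<le> real (t' - p) * (D t')\<^sup>2"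
        using Suc by (intro mult_left_mono sq) auto
      also have "\<dots> \<le> C2" by (rule stretch[OF p])
      finally have b: "real (t' - p) * (D t)\<^sup>2 \<le> C2" .
      have "real t = real p + real (t' - p) + 1" using p(1) Suc by (simp add: of_nat_diff)
      then have "real t * (D t)\<^sup>2 = real p * (D t)\<^sup>2 + real (t' - p) * (D t)\<^sup>2 + (D t)\<^sup>2"
        by (simp add: algebra_simps)
      then show ?thesis using a b sq[of 0 t] K by simp
    qed
  qed
  have "real t * (D t)\<^sup>2 \<le> K + C2" for t
  proof -
    obtain p where p: "p \<le> t" "P p" "\<forall>j\<in>{p<..t}. \<not> P j" using last by blast
    have "real p * (D t)\<^sup>2 \<le> real p * (D p)\<^sup>2"
      using p(1) by (intro mult_left_mono sq) auto
    also have "\<dots> \<le> K" by (rule pruned[OF p(2)])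
    finally have "real p * (D t)\<^sup>2 \<le> K" .
    moreover have "real t * (D t)\<^sup>2 = real p * (D t)\<^sup>2 + real (t - p) * (D t)\<^sup>2"
      using p(1) by (simp add: of_nat_diff algebra_simps)
    ultimately show ?thesis using stretch[OF p] by simp
  qed
  then show ?thesis by blast
qed

section \<open>Runs of the method\<close>

locale level_set_run =
  fixes \<psi> \<Xi> :: "'a::{real_inner, complete_space} \<Rightarrow> ereal"
    and E :: "'a set"
    and lam :: real
    and \<E> :: "nat \<Rightarrow> 'a set"
    and \<mu> w v xhat :: "nat \<Rightarrow> 'a"
  assumes psi: "proper_fun \<psi>" "convex_fun \<psi>"
    and E: "E \<noteq> {}"
    and lam: "0 < lam" "lam < 1"
    and run: "extended_level_set_run \<psi> E \<Xi> lam \<E> \<mu> w v xhat"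
    and v_bounded: "\<exists>C. \<forall>t. norm (v t) \<le> C"
    and init_bounded: "bounded (\<E> 0)"
begin

section \<open>Notation and the clauses of a run\<close>

abbreviation "gap \<equiv> els_gap \<psi> E \<E> \<mu> v"
abbreviation "refgap \<equiv> els_ref_gap \<psi> E lam \<E> \<mu> v"
abbreviation "upper \<equiv> els_upper \<psi> E \<mu>"
abbreviation "lower \<equiv> els_lower \<psi> \<E> v"
abbreviation "level \<equiv> els_level \<psi> E lam \<E> \<mu> v"
abbreviation "Q \<equiv> els_Q \<psi> E lam \<E> \<mu> v"
abbreviation "pruned t \<equiv> gap t < ereal (1 - lam) * refgap t"

lemma oracle_subgradient: "v t \<in> subdifferential (support_function E) (\<mu> t)"
  using run unfolding extended_level_set_run_def by blast

lemma xhat_min: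
  "is_arg_min (\<lambda>x. fenchel_conjugate \<psi> x
      + convex_indicator (uminus ` closure (convex hull (\<E> t \<union> {v t}))) x) (\<lambda>x. True) (xhat t)"
  using run unfolding extended_level_set_run_def by blast

lemma bundle_update:
  "if pruned t
   then \<E> (Suc t) \<subseteq> closure (convex hull (\<E> t \<union> {v t})) \<and>
     {- xhat t} \<union> \<E> 0 \<subseteq> closure (convex hull (\<E> (Suc t)))
   else \<E> (Suc t) = \<E> t \<union> {v t}"
  using run unfolding extended_level_set_run_def by blast

lemma bundle_pruned:
  assumes "pruned t"
  shows "\<E> (Suc t) \<subseteq> closure (convex hull (\<E> t \<union> {v t}))"
    and "- xhat t \<in> closure (convex hull (\<E> (Suc t)))"
    and "\<E> 0 \<subseteq> closure (convex hull (\<E> (Suc t)))"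
  using bundle_update[of t] unfolding if_P[OF assms] by blast+

lemma bundle_kept:
  assumes "\<not> pruned t"
  shows "\<E> (Suc t) = \<E> t \<union> {v t}"
  using bundle_update[of t] unfolding if_not_P[OF assms] .

lemma mu_in_Q: "\<mu> (Suc t) \<in> Q t"
  using run unfolding extended_level_set_run_def is_arg_min_def by blast

lemma w_subgradient: "w t \<in> subdifferential \<Xi> (\<mu> t)"
proof (cases t)
  case 0
  then show ?thesis using run unfolding extended_level_set_run_def by blast
next
  case (Suc s)
  then show ?thesis using run unfolding extended_level_set_run_def by blast
qed

lemma w_normal:
  assumes "y \<in> Q t"
  shows "(w t - w (Suc t)) \<bullet> (y - \<mu> (Suc t)) \<le> 0"
proof -
  have "w t - w (Suc t) \<in> normal_cone (Q t) (\<mu> (Suc t))"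
    using run unfolding extended_level_set_run_def by blast
  then show ?thesis using mu_in_Q[of t] assms by (simp add: normal_cone_def)
qed

section \<open>Bundle models compared with the support function of E\<close>

lemma bundle_step: "\<E> (Suc t) \<subseteq> closure (convex hull (\<E> t \<union> {v t}))"
proof (cases "pruned t")
  case True
  then show ?thesis by (rule bundle_pruned(1))
next
  case False
  show ?thesis
    unfolding bundle_kept[OF False] using hull_subset closure_subset by (rule order_trans)
qed

lemma bundle_nonempty: "\<E> (Suc t) \<noteq> {}"
proof (cases "pruned t")
  case True
  from bundle_pruned(2)[OF this] show ?thesis by auto
next
  case False
  show ?thesis unfolding bundle_kept[OF False] by simp
qed

text \<open>Pruning retains the initial bundle in the closed hull. This confines all level sets to
  one sublevel set of the initial model.\<close>

lemma init_le_bundle: "support_function (\<E> 0) x \<le> support_function (\<E> t) x"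
proof (induction t)
  case (Suc t)
  show ?case
  proof (cases "pruned t")
    case True
    then show ?thesis by (intro support_function_subset_hull bundle_pruned(3))
  next
    case False
    show ?thesis
      unfolding bundle_kept[OF False] support_function_Un using Suc by (simp add: le_max_iff_disj)
  qed
qed simp

lemma support_E_oracle: "support_function E (\<mu> t) = ereal (\<mu> t \<bullet> v t)"
  using oracle_subgradient E by (rule support_function_subgradient(2))

lemma oracle_le_E: "ereal (x \<bullet> v t) \<le> support_function E x"
  using oracle_subgradient E by (rule support_function_subgradient(1))

lemma bundle_le_E: "support_function (\<E> t) x \<le> support_function E x"
proof (induction t)
  case 0
  then show ?case
    using run unfolding extended_level_set_run_def by (intro support_function_mono) blast
next
  case (Suc t)
  have "support_function (\<E> (Suc t)) x \<le> support_function (\<E> t \<union> {v t}) x"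
    by (rule support_function_subset_hull[OF bundle_step])
  also have "\<dots> \<le> support_function E x"
    unfolding support_function_Un support_function_singleton using Suc oracle_le_E by simp
  finally show ?case .
qed

lemma model_le_E: "support_function (\<E> t \<union> {v t}) x \<le> support_function E x"
  unfolding support_function_Un support_function_singleton using bundle_le_E oracle_le_E by simp

text \<open>Closed hulls of bounded sets are bounded, so this survives pruning; the duality argument
  requires it.\<close>

lemma model_bounded: "bounded (\<E> t \<union> {v t})"
proof -
  have "bounded (\<E> t)"
  proof (induction t)
    case 0
    then show ?case by (rule init_bounded)
  next
    case (Suc t)
    then have "bounded (closure (convex hull (\<E> t \<union> {v t})))"
      by (intro bounded_closure bounded_convex_hull) simp
    then show ?case using bundle_step by (rule bounded_subset)
  qed
  then show ?thesis by simp
qed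

section \<open>Finite bounds and monotonicity of the gap\<close>

lemma psi_not_minf: "\<psi> x \<noteq> -\<infinity>"
  using psi(1) by (simp add: proper_fun_def)

lemma upper_antimono: "s \<le> t \<Longrightarrow> upper t \<le> upper s"
  by (rule lift_Suc_antimono_le) simp_all

lemma upper_le: "upper t \<le> \<psi> (\<mu> t) + support_function E (\<mu> t)"
  by (cases t) auto

lemma upper_0: "upper 0 = \<psi> (\<mu> 0) + support_function E (\<mu> 0)"
  by simp

lemma psi_mu_0_finite: "\<bar>\<psi> (\<mu> 0)\<bar> \<noteq> \<infinity>"
proof -
  have "\<mu> 0 \<in> effective_domain \<psi>" using run unfolding extended_level_set_run_def by blast
  then show ?thesis by (simp add: effective_domain_def)
qed

lemma upper_not_inf: "upper t \<noteq> \<infinity>"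
proof -
  have "upper 0 \<noteq> \<infinity>"
    using psi_mu_0_finite by (auto simp: support_E_oracle)
  then show ?thesis using upper_antimono[of 0 t] by auto
qed

lemma lower_le_upper: "lower t \<le> upper s"
proof -
  have "lower t \<le> \<psi> x + support_function E x" for x
    unfolding els_lower_def by (rule INF_lower2[of x]) (simp, intro add_left_mono model_le_E)
  then show ?thesis by (induction s) auto
qed

text \<open>An infinite gap would make the next level set empty, so its projection could not exist.\<close>

lemma lower_not_minf: "lower t \<noteq> -\<infinity>"
proof
  assume "lower t = -\<infinity>"
  then have "level t = -\<infinity>"
    using upper_not_inf[of t] lam by (cases "upper t") (auto simp: els_level_def)
  then have "\<psi> (\<mu> (Suc t)) + support_function (\<E> (Suc t)) (\<mu> (Suc t)) = -\<infinity>"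
    using mu_in_Q[of t] by (simp add: els_Q_def)
  then show False
    using psi_not_minf support_function_not_minf[OF bundle_nonempty] by (simp add: ereal_plus_eq_MInfty)
qed

definition "u t = real_of_ereal (upper t)"
definition "l t = real_of_ereal (lower t)"
definition "D t = u t - l t"

lemma upper_eq: "upper t = ereal (u t)"
  unfolding u_def using upper_not_inf[of t] lower_le_upper[of t t] lower_not_minf[of t]
  by (cases "upper t") auto

lemma lower_eq: "lower t = ereal (l t)"
  unfolding l_def using upper_not_inf[of t] lower_le_upper[of t t] lower_not_minf[of t]
  by (cases "lower t") auto

lemma gap_eq: "gap t = ereal (D t)"
  by (simp add: els_gap_def upper_eq lower_eq D_def)

lemma level_eq: "level t = ereal (u t - (1 - lam) * D t)"
  by (simp add: els_level_def upper_eq lower_eq D_def algebra_simps)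

lemma D_nonneg: "0 \<le> D t"
  using lower_le_upper[of t t] by (simp add: upper_eq lower_eq D_def)

lemma u_antimono: "s \<le> t \<Longrightarrow> u t \<le> u s"
  using upper_antimono[of s t] by (simp add: upper_eq)

lemma lower_le_model: "ereal (l t) \<le> \<psi> x + support_function (\<E> t \<union> {v t}) x"
  unfolding lower_eq[symmetric] els_lower_def by (rule INF_lower) simp

text \<open>By duality the linear functional of \<open>- xhat t\<close> alone keeps the lower bound, which is why
  pruning may forget all other elements of the bundle.\<close>

lemma lower_le_xhat: "ereal (l t) \<le> \<psi> x + ereal (x \<bullet> - xhat t)"
proof -
  let ?S = "\<E> t \<union> {v t}"
  let ?obj = "\<lambda>x. fenchel_conjugate \<psi> x + convex_indicator (uminus ` closure (convex hull ?S)) x"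
  \<comment> \<open>Approximate duality gives a feasible competitor \<open>- p\<close> within
    \<open>\<epsilon>\<close> of the dual bound. Minimality of \<open>xhat t\<close> then removes
    the slack, as \<open>xhat t\<close> does not depend on \<open>\<epsilon>\<close>.\<close>
  have "?obj (xhat t) \<le> ereal (- l t + \<epsilon>)" if eps: "\<epsilon> > 0" for \<epsilon>
  proof -
    obtain p where p: "p \<in> closure (convex hull ?S)"
      "\<And>x. ereal (l t - \<epsilon>) \<le> \<psi> x + ereal (p \<bullet> x)"
      using fenchel_duality_approx[OF psi(2,1) model_bounded _ lower_le_model eps] by blast
    have "ereal (- p \<bullet> x) - \<psi> x \<le> ereal (- l t + \<epsilon>)" for x
      using p(2)[of x] by (cases "\<psi> x") auto
    then have "fenchel_conjugate \<psi> (- p) \<le> ereal (- l t + \<epsilon>)"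
      unfolding fenchel_conjugate_def by (rule SUP_least)
    moreover have "?obj (- p) = fenchel_conjugate \<psi> (- p)"
      using p(1) by (simp add: convex_indicator_def)
    moreover have "?obj (xhat t) \<le> ?obj (- p)"
      using xhat_min[of t] unfolding is_arg_min_def by (meson not_less)
    ultimately show ?thesis by simp
  qed
  then have "?obj (xhat t) \<le> ereal (- l t)"
    by (metis ereal_le_epsilon2 plus_ereal.simps(1))
  moreover have "fenchel_conjugate \<psi> (xhat t) \<le> ?obj (xhat t)"
    by (simp add: convex_indicator_def)
  ultimately have "fenchel_conjugate \<psi> (xhat t) \<le> ereal (- l t)" by order
  moreover have "ereal (xhat t \<bullet> x) - \<psi> x \<le> fenchel_conjugate \<psi> (xhat t)"
    unfolding fenchel_conjugate_def by (rule SUP_upper) simp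
  ultimately have "ereal (xhat t \<bullet> x) - \<psi> x \<le> ereal (- l t)" by order
  then show ?thesis
    by (cases "\<psi> x") (auto simp: inner_commute)
qed

lemma l_mono: "s \<le> t \<Longrightarrow> l s \<le> l t"
proof (rule lift_Suc_mono_le)
  fix t
  have "ereal (l t) \<le> \<psi> x + support_function (\<E> (Suc t)) x" for x
  proof (cases "pruned t")
    case True
    have "ereal (x \<bullet> - xhat t) \<le> support_function (closure (convex hull \<E> (Suc t))) x"
      using bundle_pruned(2)[OF True] by (rule support_function_ge)
    then show ?thesis
      using lower_le_xhat[of t x] unfolding support_function_closure_hull
      by (meson add_left_mono order_trans)
  next
    case False
    then show ?thesis using lower_le_model[of t x] by (simp add: bundle_kept)
  qed
  then have "ereal (l t) \<le> lower (Suc t)"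
    unfolding els_lower_def
    by (intro INF_greatest) (meson Un_upper1 add_left_mono order_trans support_function_mono)
  then show "l t \<le> l (Suc t)" by (simp add: lower_eq)
qed

lemma D_antimono: "s \<le> t \<Longrightarrow> D t \<le> D s"
  using u_antimono[of s t] l_mono[of s t] by (simp add: D_def)

section \<open>Pruning iterations and the reference gap\<close>

lemma pruned_0: "pruned 0"
  \<comment> \<open>The reference gap starts at infinity and the first gap is finite, so iteration 0
    prunes and every iteration has a last pruning at or before it.\<close>
  using lam by (simp add: gap_eq)

text \<open>\<open>refgap\<close> is read at the start of an iteration, so the value set at
  \<open>p\<close> is first visible at \<open>Suc p\<close>.\<close>

lemma refgap_after_pruning:
  assumes "p \<le> t" "pruned p" "\<forall>j\<in>{p<..t}. \<not> pruned j"
  shows "refgap (Suc t) = ereal (D p)"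
  using assms
proof (induction t rule: dec_induct)
  case base
  then show ?case by (simp add: gap_eq)
next
  case (step t)
  have "refgap (Suc t) = ereal (D p)" using step by auto
  moreover have "\<not> pruned (Suc t)"
    using step.prems(2) step.hyps(1) by (meson greaterThanAtMost_iff le_refl less_Suc_eq_le)
  ultimately show ?case by (simp only: els_ref_gap.simps(2)[of _ _ _ _ _ _ "Suc t"] if_False)
qed

lemma pruned_Suc_iff:
  assumes "p \<le> t" "pruned p" "\<forall>j\<in>{p<..t}. \<not> pruned j"
  shows "pruned (Suc t) \<longleftrightarrow> D (Suc t) < (1 - lam) * D p"
  by (simp only: refgap_after_pruning[OF assms] gap_eq times_ereal.simps ereal_less_eq less_ereal.simps)

lemma bundle_nested:
  assumes "s \<le> t" "\<forall>j\<in>{s..<t}. \<not> pruned j"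
  shows "\<E> s \<subseteq> \<E> t"
  using assms
proof (induction t rule: dec_induct)
  case (step t)
  then have "\<E> s \<subseteq> \<E> t" by auto
  moreover have "\<E> (Suc t) = \<E> t \<union> {v t}" using step by (intro bundle_kept) auto
  ultimately show ?case by blast
qed simp

section \<open>Confinement to the initial sublevel set\<close>

lemma psi_mu_finite: "\<bar>\<psi> (\<mu> t)\<bar> \<noteq> \<infinity>"
proof (cases t)
  case 0
  then show ?thesis using psi_mu_0_finite by simp
next
  case (Suc s)
  have "\<psi> (\<mu> t) + support_function (\<E> t) (\<mu> t) \<le> level s"
    using mu_in_Q[of s] Suc by (simp add: els_Q_def)
  then show ?thesis
    using psi_not_minf[of "\<mu> t"] by (auto simp: level_eq)
qed

text \<open>Levels never exceed the first upper bound and models never fall below the initial one.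
  On the right stands the set \<open>Q\<close> with index -1, where \<Xi> is bounded.\<close>

lemma Q_subset_init:
  "Q t \<subseteq> {x. \<psi> x + support_function (\<E> 0) x \<le> upper 0}"
proof
  fix x assume "x \<in> Q t"
  then have "\<psi> x + support_function (\<E> (Suc t)) x \<le> level t" by (simp add: els_Q_def)
  moreover have "level t \<le> upper 0"
    using u_antimono[of 0 t] D_nonneg[of t] lam unfolding level_eq upper_eq
    by (simp add: mult_nonneg_nonneg add_increasing2 diff_le_eq)
  moreover have "\<psi> x + support_function (\<E> 0) x \<le> \<psi> x + support_function (\<E> (Suc t)) x"
    by (intro add_left_mono init_le_bundle)
  ultimately have "\<psi> x + support_function (\<E> 0) x \<le> upper 0" by order
  then show "x \<in> {x. \<psi> x + support_function (\<E> 0) x \<le> upper 0}" by simp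
qed

lemma mu_in_init: "\<mu> t \<in> {x. \<psi> x + support_function (\<E> 0) x \<le> upper 0}"
proof (cases t)
  case 0
  then show ?thesis
    using add_left_mono[OF bundle_le_E[of 0 "\<mu> 0"]] by (simp del: els_upper.simps add: upper_0)
next
  case (Suc s)
  then show ?thesis using mu_in_Q[of s] Q_subset_init by blast
qed

section \<open>Groups of iterations without pruning\<close>

lemma step_length:
  assumes C: "norm (v t) \<le> Cv" and t: "\<not> pruned t"
    and lip: "\<bar>\<psi> (\<mu> (Suc t)) - \<psi> (\<mu> t)\<bar> \<le> ereal (Cp * norm (\<mu> (Suc t) - \<mu> t))"
  shows "(1 - lam) * D t \<le> (Cp + Cv) * norm (\<mu> (Suc t) - \<mu> t)"
proof -
  obtain a b where ab: "\<psi> (\<mu> t) = ereal a" "\<psi> (\<mu> (Suc t)) = ereal b"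
    using psi_mu_finite by (metis ereal_real')
  \<comment> \<open>As the bundle keeps \<open>v t\<close>, the sum of \<psi> and this cut is at
    least \<open>u t\<close> at \<open>\<mu> t\<close> and at most the level at
    \<open>\<mu> (Suc t)\<close>. The drop \<open>(1 - lam) * D t\<close> is paid for by the
    Lipschitz constant \<open>Cp + Cv\<close>.\<close>
  have "v t \<in> \<E> (Suc t)" using t by (simp add: bundle_kept)
  then have "ereal b + ereal (\<mu> (Suc t) \<bullet> v t)
      \<le> \<psi> (\<mu> (Suc t)) + support_function (\<E> (Suc t)) (\<mu> (Suc t))"
    unfolding ab by (intro add_left_mono support_function_ge)
  also have "\<dots> \<le> level t" using mu_in_Q[of t] by (simp add: els_Q_def)
  finally have "b + \<mu> (Suc t) \<bullet> v t \<le> u t - (1 - lam) * D t" by (simp add: level_eq)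
  moreover have "u t \<le> a + \<mu> t \<bullet> v t"
    using upper_le[of t] by (simp add: upper_eq support_E_oracle ab)
  moreover have "a - b \<le> Cp * norm (\<mu> (Suc t) - \<mu> t)" using lip by (simp add: ab)
  moreover have "\<mu> t \<bullet> v t - \<mu> (Suc t) \<bullet> v t \<le> Cv * norm (\<mu> (Suc t) - \<mu> t)"
  proof -
    have "(\<mu> t - \<mu> (Suc t)) \<bullet> v t \<le> norm (\<mu> t - \<mu> (Suc t)) * norm (v t)"
      by (rule norm_cauchy_schwarz)
    also have "\<dots> \<le> norm (\<mu> t - \<mu> (Suc t)) * Cv" by (intro mult_left_mono C) simp
    finally show ?thesis by (simp add: inner_simps norm_minus_commute mult.commute)
  qed
  ultimately show ?thesis by (simp add: distrib_right)
qed

text \<open>The last lower bound lies strictly below \<open>u e - (1 - lam) * D s\<close>, so some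
  point attains a smaller value in the last model. Earlier models of the group are smaller, and its
  levels are at least that number.\<close>

lemma common_point:
  assumes "\<forall>j\<in>{s<..e}. \<not> pruned j" and D: "(1 - lam) * D s < D e"
  shows "\<exists>x. \<forall>t\<in>{s..<e}. x \<in> Q t"
proof -
  have "lower e < ereal (u e - (1 - lam) * D s)"
    using D by (simp add: lower_eq D_def)
  then obtain x where x: "\<psi> x + support_function (\<E> e \<union> {v e}) x < ereal (u e - (1 - lam) * D s)"
    unfolding els_lower_def INF_less_iff by blast
  have "x \<in> Q t" if t: "t \<in> {s..<e}" for t
  proof -
    \<comment> \<open>Iteration \<open>s\<close> itself may prune: \<open>\<E> (Suc s)\<close> is
      already the bundle after that.\<close>
    have "\<E> (Suc t) \<subseteq> \<E> e" using t assms(1) by (intro bundle_nested) auto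
    then have "support_function (\<E> (Suc t)) x \<le> support_function (\<E> e \<union> {v e}) x"
      by (intro support_function_mono) blast
    then have "\<psi> x + support_function (\<E> (Suc t)) x \<le> \<psi> x + support_function (\<E> e \<union> {v e}) x"
      by (rule add_left_mono)
    moreover have "ereal (u e - (1 - lam) * D s) \<le> level t"
    proof -
      have "(1 - lam) * D t \<le> (1 - lam) * D s"
        using t lam by (intro mult_left_mono D_antimono) auto
      then show ?thesis using u_antimono[of t e] t by (simp add: level_eq)
    qed
    ultimately have "\<psi> x + support_function (\<E> (Suc t)) x \<le> level t" using x by order
    then show ?thesis by (simp add: els_Q_def)
  qed
  then show ?thesis by blast
qed

lemma group_bound:
  assumes sc: "strongly_convex_fun \<beta> \<Xi>" and beta: "0 < \<beta>"
    and Xi: "\<And>x. x \<in> {x. \<psi> x + support_function (\<E> 0) x \<le> upper 0} \<Longrightarrow> \<bar>\<Xi> x\<bar> \<le> ereal M"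
    and R: "\<And>x. x \<in> {x. \<psi> x + support_function (\<E> 0) x \<le> upper 0} \<Longrightarrow> norm x \<le> R"
    and w: "\<And>t. norm (w t) \<le> Cw" and v: "\<And>t. norm (v t) \<le> Cv" "0 \<le> Cv"
    and lip: "\<And>t. \<bar>\<psi> (\<mu> (Suc t)) - \<psi> (\<mu> t)\<bar> \<le> ereal (Cp * norm (\<mu> (Suc t) - \<mu> t))" "0 < Cp"
    and se: "s \<le> e" "\<forall>j\<in>{s<..e}. \<not> pruned j" "(1 - lam) * D s < D e"
  shows "real (e - s) * (D e)\<^sup>2
    \<le> (2 * M + 2 * R * Cw) * (2 * (Cp + Cv)\<^sup>2 / (\<beta> * (1 - lam)\<^sup>2)) + (D 0)\<^sup>2"
    (is "_ \<le> ?B * ?c + _")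
proof -
  define \<xi> where "\<xi> x = real_of_ereal (\<Xi> x)" for x
  have xi: "\<Xi> x = ereal (\<xi> x)" "\<bar>\<xi> x\<bar> \<le> M"
    if "x \<in> {x. \<psi> x + support_function (\<E> 0) x \<le> upper 0}" for x
    using Xi[OF that] by (cases "\<Xi> x"; simp add: \<xi>_def)+
  have M: "0 \<le> M" using xi(2)[OF mu_in_init[of 0]] by simp
  have R0: "0 \<le> R" using R[OF mu_in_init[of 0]] norm_ge_zero[of "\<mu> 0"] by linarith
  have Cw: "0 \<le> Cw" using w[of 0] norm_ge_zero[of "w 0"] by linarith
  have c0: "0 \<le> ?c" using beta by simp
  have B0: "0 \<le> ?B" using M R0 Cw by simp
  \<comment> \<open>The real-valued Bregman distance to \<open>x\<close> at iteration
    \<open>t\<close>; \<open>?B\<close> bounds it by \<open>2 * M\<close> for the values of \<Xi>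
    and \<open>2 * R * Cw\<close> for the linear term.\<close>
  define B where "B t x = \<xi> x - \<xi> (\<mu> t) - w t \<bullet> (x - \<mu> t)" for t x
  have B_lower: "\<beta> / 2 * (norm (x - \<mu> t))\<^sup>2 \<le> B t x"
    if "x \<in> {x. \<psi> x + support_function (\<E> 0) x \<le> upper 0}" for t x
    using strongly_convex_subgradient[OF sc w_subgradient xi(1)[OF mu_in_init] xi(1)[OF that]]
    by (simp add: B_def algebra_simps)
  have B_upper: "B t x \<le> ?B"
    if x: "x \<in> {x. \<psi> x + support_function (\<E> 0) x \<le> upper 0}" for t x
  proof -
    have "- (w t \<bullet> (x - \<mu> t)) \<le> norm (w t) * norm (x - \<mu> t)"
      using norm_cauchy_schwarz[of "w t" "- (x - \<mu> t)"] by (simp add: inner_simps norm_minus_commute)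
    also have "\<dots> \<le> Cw * (2 * R)"
    proof (intro mult_mono w)
      show "norm (x - \<mu> t) \<le> 2 * R"
        using norm_triangle_ineq4[of x "\<mu> t"] R[OF x] R[OF mu_in_init[of t]] by simp
    qed (use Cw in auto)
    finally show ?thesis
      using xi(2)[OF x] xi(2)[OF mu_in_init[of t]] by (simp add: B_def mult_ac)
  qed
  have De: "(D e)\<^sup>2 \<le> (D 0)\<^sup>2"
    using D_antimono[of 0 e] D_nonneg by (intro power_mono) auto
  show ?thesis
  proof (cases "e = s")
    case True
    have "0 \<le> ?B * ?c + (D 0)\<^sup>2"
      by (intro add_nonneg_nonneg mult_nonneg_nonneg[OF B0 c0]) simp
    then show ?thesis using True by simp
  next
    case False
    then have se': "Suc s \<le> e" using se(1) by simp
    obtain x where x: "\<forall>t\<in>{s..<e}. x \<in> Q t" using common_point[OF se(2,3)] by blast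
    have xQ: "x \<in> {x. \<psi> x + support_function (\<E> 0) x \<le> upper 0}"
      using bspec[OF x, of s] se' Q_subset_init[of s] by auto
    \<comment> \<open>The range starts at \<open>Suc s\<close> because \<open>step_length\<close>
      excludes pruning, which may occur at \<open>s\<close>. The term \<open>(D 0)\<^sup>2\<close>
      of the bound covers that iteration.\<close>
    have step: "(D e)\<^sup>2 \<le> ?c * (B t x - B (Suc t) x)" if t: "t \<in> {Suc s..<e}" for t
    proof -
      let ?n = "norm (\<mu> (Suc t) - \<mu> t)"
      have "(w t - w (Suc t)) \<bullet> (x - \<mu> (Suc t)) \<le> 0" using x t by (intro w_normal) auto
      \<comment> \<open>Three-point identity: the two sides differ exactly by the inner product that
        the normal cone condition signs.\<close>
      then have "B t (\<mu> (Suc t)) \<le> B t x - B (Suc t) x"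
        by (simp add: B_def inner_simps)
      then have n: "\<beta> / 2 * ?n\<^sup>2 \<le> B t x - B (Suc t) x"
        using B_lower[OF mu_in_init[of "Suc t"], of t] by linarith
      have "(1 - lam) * D e \<le> (1 - lam) * D t"
        using t lam by (intro mult_left_mono D_antimono) auto
      also have "\<dots> \<le> (Cp + Cv) * ?n"
        using t se(2) by (intro step_length v lip) auto
      finally have "((1 - lam) * D e)\<^sup>2 \<le> ((Cp + Cv) * ?n)\<^sup>2"
        using lam D_nonneg by (intro power_mono) auto
      then have "(1 - lam)\<^sup>2 * (D e)\<^sup>2 \<le> (Cp + Cv)\<^sup>2 * ?n\<^sup>2"
        by (simp add: power_mult_distrib)
      then have "(D e)\<^sup>2 \<le> ?c * (\<beta> / 2 * ?n\<^sup>2)"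
        using beta lam by (simp add: field_simps)
      also have "\<dots> \<le> ?c * (B t x - B (Suc t) x)" by (intro mult_left_mono n c0)
      finally show ?thesis .
    qed
    have "real (e - Suc s) * (D e)\<^sup>2 = (\<Sum>t\<in>{Suc s..<e}. (D e)\<^sup>2)" by simp
    also have "\<dots> \<le> (\<Sum>t\<in>{Suc s..<e}. ?c * (B t x - B (Suc t) x))" by (rule sum_mono[OF step])
    also have "\<dots> = ?c * (B (Suc s) x - B e x)"
      unfolding sum_distrib_left[symmetric]
      using sum_Suc_diff'[OF se', of "\<lambda>t. - B t x"] by simp
    also have "\<dots> \<le> ?c * ?B"
    proof (intro mult_left_mono c0)
      have "0 \<le> \<beta> / 2 * (norm (x - \<mu> e))\<^sup>2" using beta by simp
      then show "B (Suc s) x - B e x \<le> ?B"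
        using B_upper[OF xQ, of "Suc s"] B_lower[OF xQ, of e] by linarith
    qed
    finally have "real (e - Suc s) * (D e)\<^sup>2 \<le> ?B * ?c" by (simp add: mult.commute)
    moreover have "real (e - s) * (D e)\<^sup>2 = real (e - Suc s) * (D e)\<^sup>2 + (D e)\<^sup>2"
      using se' by (simp add: of_nat_diff algebra_simps)
    ultimately show ?thesis using De by linarith
  qed
qed

lemma init_sublevel_bounded:
  assumes "coercive (\<lambda>x. \<psi> x + support_function (\<E> 0) x)"
  shows "\<exists>R. \<forall>x\<in>{x. \<psi> x + support_function (\<E> 0) x \<le> upper 0}. norm x \<le> R"
proof -
  have "eventually (\<lambda>x. ereal (u 0) < \<psi> x + support_function (\<E> 0) x) at_infinity"
    using assms unfolding coercive_def by (rule order_tendstoD) simp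
  then obtain R where R: "\<And>x. R \<le> norm x \<Longrightarrow> ereal (u 0) < \<psi> x + support_function (\<E> 0) x"
    unfolding eventually_at_infinity by blast
  have "norm x \<le> R" if "\<psi> x + support_function (\<E> 0) x \<le> upper 0" for x
    using R[of x] that unfolding upper_eq by (meson linorder_le_cases not_less)
  then show ?thesis by blast
qed

end

section \<open>Convergence rate of the gap\<close>

theorem theorem3p7:
  fixes \<psi> \<Xi> :: "'a::{real_inner, complete_space} \<Rightarrow> ereal"
    and E :: "'a set"
    and \<beta> lam :: real
    and \<E> :: "nat \<Rightarrow> 'a set"
    and \<mu> w v xhat :: "nat \<Rightarrow> 'a"
  assumes psi: "\<psi> \<in> Gamma0"
    and E: "E \<noteq> {}" "closed E" "convex E"
    and beta: "\<beta> > 0"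
    and Xi: "\<Xi> \<in> Gamma0" "strongly_convex_fun \<beta> \<Xi>"
    and lam: "0 < lam" "lam < 1"
    and run: "extended_level_set_run \<psi> E \<Xi> lam \<E> \<mu> w v xhat"
    and a1: "effective_domain (support_function E) \<inter> subdifferential_domain \<Xi>
               \<inter> effective_domain \<psi> \<noteq> {}"
    and a2: "\<forall>t. subdifferential (support_function E) (\<mu> t) \<noteq> {}"
            "\<exists>C_oracle. \<forall>t. norm (v t) \<le> C_oracle"
    and a3: "bounded (\<E> 0)" "coercive (\<lambda>x. \<psi> x + support_function (\<E> 0) x)"
    and a4: "{x. \<psi> x + support_function (\<E> 0) x \<le> els_upper \<psi> E \<mu> 0} \<subseteq> effective_domain \<Xi>"
            "\<exists>M::real. \<forall>x\<in>{x. \<psi> x + support_function (\<E> 0) x \<le> els_upper \<psi> E \<mu> 0}.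
               \<bar>\<Xi> x\<bar> \<le> ereal M"
    and a5: "\<forall>t. \<exists>w'\<in>subdifferential \<Xi> (\<mu> (Suc t)).
               w t - w' \<in> normal_cone (els_Q \<psi> E lam \<E> \<mu> v t) (\<mu> (Suc t))"
            "\<exists>C_Xi>0. \<forall>t. norm (w t) \<le> C_Xi"
    and a6: "\<exists>C_psi>0. \<forall>t. \<bar>\<psi> (\<mu> (Suc t)) - \<psi> (\<mu> t)\<bar> \<le> ereal (C_psi * norm (\<mu> (Suc t) - \<mu> t))"
  shows "els_gap \<psi> E \<E> \<mu> v \<longlonglongrightarrow> 0 \<and>
         (\<exists>C>0. \<forall>t\<ge>1. els_gap \<psi> E \<E> \<mu> v t \<le> ereal (C / sqrt (real t)))"
proof -
  have "proper_fun \<psi>" "convex_fun \<psi>" using psi by (simp_all add: Gamma0_def)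
  interpret level_set_run \<psi> \<Xi> E lam \<E> \<mu> w v xhat
    by (intro level_set_run.intro) fact+
  obtain M where M: "\<forall>x\<in>{x. \<psi> x + support_function (\<E> 0) x \<le> upper 0}. \<bar>\<Xi> x\<bar> \<le> ereal M"
    using a4(2) by blast
  obtain R where R: "\<forall>x\<in>{x. \<psi> x + support_function (\<E> 0) x \<le> upper 0}. norm x \<le> R"
    using init_sublevel_bounded[OF a3(2)] by blast
  obtain Cw where Cw: "\<And>t. norm (w t) \<le> Cw" using a5(2) by blast
  obtain Cv where Cv: "\<And>t. norm (v t) \<le> Cv" using a2(2) by blast
  have Cv0: "0 \<le> Cv" using Cv[of 0] norm_ge_zero[of "v 0"] by linarith
  obtain Cp where Cp: "0 < Cp"
    "\<And>t. \<bar>\<psi> (\<mu> (Suc t)) - \<psi> (\<mu> t)\<bar> \<le> ereal (Cp * norm (\<mu> (Suc t) - \<mu> t))"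
    using a6 by blast
  define C where "C = (2 * M + 2 * R * Cw) * (2 * (Cp + Cv)\<^sup>2 / (\<beta> * (1 - lam)\<^sup>2)) + (D 0)\<^sup>2"
  have group: "real (e - s) * (D e)\<^sup>2 \<le> C"
    if "s \<le> e" "\<forall>j\<in>{s<..e}. \<not> pruned j" "(1 - lam) * D s < D e" for s e
    unfolding C_def using M R Cw Cv Cv0 Cp beta Xi(2) that by (intro group_bound) auto
  have "\<exists>K. \<forall>t. real t * (D t)\<^sup>2 \<le> K"
  proof (rule gap_square_bound[where P = pruned and q = "1 - lam" and C = "max 0 C"])
    show "pruned (Suc t) \<longleftrightarrow> D (Suc t) < (1 - lam) * D p"
      if "p \<le> t" "pruned p" "\<forall>j\<in>{p<..t}. \<not> pruned j" for p t
      using that by (rule pruned_Suc_iff)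
    show "real (e - s) * (D e)\<^sup>2 \<le> max 0 C"
      if "s \<le> e" "\<forall>j\<in>{s<..e}. \<not> pruned j" "(1 - lam) * D s < D e" for s e
      using group[OF that] by simp
  qed (use lam D_nonneg D_antimono pruned_0 in auto)
  then obtain K where K: "\<And>t. real t * (D t)\<^sup>2 \<le> K" by blast
  \<comment> \<open>The absolute value and the added 1 make the constant positive whatever the sign
    of \<open>K\<close>.\<close>
  define c where "c = sqrt (\<bar>K\<bar> + 1)"
  have c: "0 < c" by (simp add: c_def)
  have rate: "D t \<le> c / sqrt (real t)" if t: "t \<ge> 1" for t
  proof -
    have "sqrt (real t) * D t = sqrt (real t * (D t)\<^sup>2)"
      using D_nonneg[of t] by (simp add: real_sqrt_mult)
    also have "\<dots> \<le> c" unfolding c_def using K[of t] by simp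
    finally show ?thesis using t by (simp add: field_simps)
  qed
  have "(\<lambda>t. c / sqrt (real t)) \<longlonglongrightarrow> 0"
    by (intro tendsto_divide_0[OF tendsto_const] filterlim_at_top_imp_at_infinity
        filterlim_compose[OF sqrt_at_top filterlim_real_sequentially])
  then have "D \<longlonglongrightarrow> 0"
    using D_nonneg rate
    by (intro tendsto_sandwich[of "\<lambda>_. 0" D sequentially "\<lambda>t. c / sqrt (real t)"])
      (auto intro: eventually_sequentiallyI[of 1])
  then have "(\<lambda>t. ereal (D t)) \<longlonglongrightarrow> ereal 0" by (rule tendsto_ereal)
  moreover have "els_gap \<psi> E \<E> \<mu> v = (\<lambda>t. ereal (D t))" by (simp add: fun_eq_iff gap_eq)
  ultimately show ?thesis using c rate by (auto simp: zero_ereal_def)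
qed

end
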